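(* Let $n \in \mathbb{N}$ and let $p$ be a real number with $\frac{\alpha}{n} \le p < 1$, where $\alpha := \ln(\frac{4}{3}) < 0.2877$. Let $X$ be a binomially distributed random variable with parameters $n$ and $p$. Then $\Pr[X > E[X]] \ge \frac{1}{4}$.
   Context: $\mathbb{N} = \{1, 2, \dots\}$. A random variable $X$ is binomially distributed with parameters $n$ and $p$ if $\Pr[X=i] = \binom{n}{i} p^i (1-p)^{n-i}$ for all $i \in \{0,1,\dots,n\}$; then $E[X] = np$. *)

theory Defs
  imports "HOL-Probability.Probability"
begin

definition binomially_distributed :: "'a measure \<Rightarrow> ('a \<Rightarrow> real) \<Rightarrow> nat \<Rightarrow> real \<Rightarrow> bool" where
  "binomially_distributed M X n p \<longleftrightarrow>
     X \<in> borel_measurable M \<and>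
     (\<forall>i\<in>{0..n}. \<P>(\<omega> in M. X \<omega> = real i) = real (n choose i) * p ^ i * (1 - p) ^ (n - i))"

end

theory Submission
  imports Defs
begin

text \<open>
  Let \<open>k = \<lfloor>np\<rfloor>\<close>. Then \<open>X > np\<close> means \<open>X \<ge> k + 1\<close>, and the probability of this
  increases with \<open>p\<close> (\<open>binomial_cdf_antimono\<close>), so for \<open>k \<ge> 1\<close> the worst case is \<open>p = k / n\<close>.
  For \<open>k = 0\<close> the complementary probability is \<open>(1 - p) ^ n \<le> exp (- n p) \<le> 3 / 4\<close>; this is where
  the constant \<open>ln (4 / 3)\<close> comes from.

  It remains to bound \<open>F n k = P (Bin n (k / n) \<le> k)\<close> by \<open>3 / 4\<close> for \<open>1 \<le> k < n\<close>. The
  value is attained at \<open>F 2 1\<close>, and every other case reduces to it by a smoothing argument in the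
  spirit of Hoeffding's theorem on sums of independent Bernoulli variables with a given mean. Put
  \<open>n = m + 1\<close>, give \<open>m\<close> trials the success probability \<open>q\<close>, and the last one the probability
  \<open>k - m q\<close> that keeps the mean equal to \<open>k\<close>. Let \<open>G q\<close> be the probability of at most \<open>k\<close>
  successes. Three values of \<open>q\<close> matter:

  \<^item> \<open>q = k / n\<close>: all trials are alike, and \<open>G q = F n k\<close>;
  \<^item> \<open>q = k / m\<close>: the last trial always fails, and \<open>G q = F m k\<close>;
  \<^item> \<open>q = (k - 1) / m\<close>: the last trial always succeeds, and \<open>G q = F m (k - 1)\<close>.

  The derivative of \<open>G\<close> factors as \<open>m (b (k - 1) - b k) (n q - k)\<close> with \<open>b\<close> the binomial weights
  for \<open>m - 1\<close> trials, and \<open>b (k - 1) \<ge> b k\<close> as long as \<open>m q \<le> k\<close>. Hence \<open>G\<close> is minimal at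
  \<open>q = k / n\<close> (\<open>split_trial_cdf_minimal\<close>), that is, \<open>F n k \<le> F (n - 1) k\<close> and
  \<open>F n k \<le> F (n - 1) (k - 1)\<close>. These two steps lead from any \<open>(n, k)\<close> down to \<open>(2, 1)\<close>
  (\<open>binomial_cdf_at_mean_le\<close>).
\<close>

section \<open>Bernstein polynomials and the binomial distribution function\<close>

definition binomial_cdf :: "nat \<Rightarrow> nat \<Rightarrow> real \<Rightarrow> real" where
  "binomial_cdf n k p = (\<Sum>i\<le>k. Bernstein n i p)"

lemma Bernstein_eq_0: "n < k \<Longrightarrow> Bernstein n k p = 0"
  by (simp add: Bernstein_def binomial_eq_0)

text \<open>Conditioning on the outcome of one of the \<open>Suc n\<close> trials.\<close>

lemma Bernstein_Suc_Suc:
  "Bernstein (Suc n) (Suc k) p = p * Bernstein n k p + (1 - p) * Bernstein n (Suc k) p"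
proof (cases "Suc k \<le> n")
  case True
  then have "n - k = Suc (n - Suc k)" by simp
  then show ?thesis by (simp add: Bernstein_def algebra_simps)
next
  case False
  then show ?thesis by (cases "k = n") (auto simp: Bernstein_def binomial_eq_0)
qed

lemma Bernstein_Suc_0: "Bernstein (Suc n) 0 p = (1 - p) * Bernstein n 0 p"
  by (simp add: Bernstein_def)

text \<open>Adding a trial turns "at most \<open>k\<close> successes" into "more than \<open>k\<close>" exactly when there
  were \<open>k\<close> successes before and the new trial succeeds.\<close>

lemma binomial_cdf_Suc:
  "binomial_cdf (Suc n) k p = binomial_cdf n k p - p * Bernstein n k p"
  by (induction k) (simp_all add: binomial_cdf_def Bernstein_Suc_0 Bernstein_Suc_Suc algebra_simps)

lemma has_real_derivative_Bernstein_Suc_0: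
  "(Bernstein (Suc n) 0 has_real_derivative - real (Suc n) * Bernstein n 0 p) (at p)"
proof -
  have "Bernstein (Suc n) 0 = (\<lambda>q. (1 - q) ^ Suc n)"
    by (simp add: Bernstein_def[abs_def])
  then show ?thesis
    by (auto simp: Bernstein_def intro!: derivative_eq_intros simp del: power_Suc of_nat_Suc)
qed

lemma has_real_derivative_Bernstein_Suc_Suc:
  "(Bernstein (Suc n) (Suc k) has_real_derivative
     real (Suc n) * (Bernstein n k p - Bernstein n (Suc k) p)) (at p)"
proof (induction n arbitrary: k)
  case 0
  show ?case
    by (cases k) (auto simp: Bernstein_def[abs_def] intro!: derivative_eq_intros)
next
  case (Suc n)
  have rec: "Bernstein (Suc (Suc n)) (Suc k) =
      (\<lambda>q. q * Bernstein (Suc n) k q + (1 - q) * Bernstein (Suc n) (Suc k) q)"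
    by (rule ext) (rule Bernstein_Suc_Suc)
  show ?case
  proof (cases k)
    case 0
    show ?thesis
      unfolding rec unfolding 0
      by (rule derivative_eq_intros has_real_derivative_Bernstein_Suc_0 Suc.IH refl)+
         (simp add: Bernstein_Suc_Suc Bernstein_Suc_0 algebra_simps)
  next
    case (Suc j)
    show ?thesis
      unfolding rec unfolding Suc
      by (rule derivative_eq_intros Suc.IH refl)+
         (simp add: Bernstein_Suc_Suc algebra_simps)
  qed
qed

text \<open>The derivatives of the summands telescope.\<close>

lemma has_real_derivative_binomial_cdf:
  "(binomial_cdf (Suc n) k has_real_derivative - real (Suc n) * Bernstein n k p) (at p)"
proof (induction k)
  case 0
  show ?case
    using has_real_derivative_Bernstein_Suc_0 by (simp add: binomial_cdf_def[abs_def])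
next
  case (Suc k)
  have rec: "binomial_cdf (Suc n) (Suc k) =
      (\<lambda>q. binomial_cdf (Suc n) k q + Bernstein (Suc n) (Suc k) q)"
    by (simp add: binomial_cdf_def[abs_def])
  show ?case
    unfolding rec
    by (rule derivative_eq_intros Suc.IH has_real_derivative_Bernstein_Suc_Suc)+
       (simp add: algebra_simps)
qed

lemma binomial_cdf_antimono:
  assumes "0 \<le> p" "p \<le> q" "q \<le> 1" "n \<ge> 1"
  shows "binomial_cdf n k q \<le> binomial_cdf n k p"
proof -
  obtain m where n: "n = Suc m" using assms by (cases n) auto
  show ?thesis
    unfolding n
  proof (rule DERIV_nonpos_imp_nonincreasing[OF assms(2)])
    fix x assume "p \<le> x" "x \<le> q"
    then have "- real (Suc m) * Bernstein m k x \<le> 0"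
      using assms Bernstein_nonneg[of x m k] by (simp add: mult_le_0_iff)
    then show "\<exists>y. DERIV (binomial_cdf (Suc m) k) x :> y \<and> y \<le> 0"
      using has_real_derivative_binomial_cdf by blast
  qed
qed

text \<open>The binomial weights decrease beyond the mode: the ratio of consecutive weights is
  \<open>(n - k) q / ((k + 1) (1 - q))\<close>, and this is at most \<open>1\<close> iff \<open>(n + 1) q \<le> k + 1\<close>.\<close>

lemma Bernstein_Suc_le:
  assumes "0 \<le> q" "q \<le> 1" "real (Suc n) * q \<le> real (Suc k)"
  shows "Bernstein n (Suc k) q \<le> Bernstein n k q"
proof (cases "k < n")
  case False
  then show ?thesis using assms by (simp add: Bernstein_eq_0 Bernstein_nonneg)
next
  case True
  have "q \<noteq> 1" using assms True by auto
  then have q: "q < 1" using assms by simp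
  have choose: "real (Suc k) * real (n choose Suc k) = real (n - k) * real (n choose k)"
    unfolding of_nat_mult[symmetric] binomial_absorption binomial_absorb_comp ..
  have "n - k = Suc (n - Suc k)" using True by simp
  then have "real (Suc k) * (1 - q) * Bernstein n (Suc k) q
      = (real (Suc k) * real (n choose Suc k)) * q * q ^ k * (1 - q) ^ (n - k)"
    by (simp add: Bernstein_def)
  also have "\<dots> = real (n - k) * q * Bernstein n k q"
    unfolding choose by (simp add: Bernstein_def)
  also have "\<dots> \<le> real (Suc k) * (1 - q) * Bernstein n k q"
    using assms True by (intro mult_right_mono Bernstein_nonneg)
      (simp_all add: of_nat_diff algebra_simps)
  finally show ?thesis using q by simp
qed

section \<open>Smoothing the success probabilities\<close>

text \<open>The probability of at most \<open>k\<close> successes in \<open>m\<close> independent trials with success probability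
  \<open>q\<close> and one further trial with success probability \<open>k - m q\<close>, so that the mean is \<open>k\<close>.\<close>

definition split_trial_cdf :: "nat \<Rightarrow> nat \<Rightarrow> real \<Rightarrow> real" where
  "split_trial_cdf m k q = binomial_cdf m k q - (real k - real m * q) * Bernstein m k q"

lemma has_real_derivative_split_trial_cdf:
  "(split_trial_cdf (Suc l) (Suc j) has_real_derivative
     real (Suc l) * (Bernstein l j q - Bernstein l (Suc j) q) *
       (real (Suc (Suc l)) * q - real (Suc j))) (at q)"
  unfolding split_trial_cdf_def[abs_def]
  by (rule derivative_eq_intros has_real_derivative_binomial_cdf
        has_real_derivative_Bernstein_Suc_Suc refl)+
     (simp add: Bernstein_Suc_Suc algebra_simps)

text \<open>The hypotheses on \<open>q\<close> say that the last success probability \<open>k - m q\<close> lies in \<open>[0, 1]\<close>.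
  On this range the derivative has the sign of \<open>(m + 1) q - k\<close>.\<close>

lemma split_trial_cdf_minimal:
  assumes k: "1 \<le> k" "k \<le> m" and q: "real k - 1 \<le> real m * q" "real m * q \<le> real k"
  shows "split_trial_cdf m k (real k / real (Suc m)) \<le> split_trial_cdf m k q"
proof -
  obtain l j where m: "m = Suc l" and j: "k = Suc j"
    using k by (metis Suc_le_D One_nat_def le_trans)
  let ?c = "real k / real (Suc m)"
  let ?D = "\<lambda>x. real m * (Bernstein l j x - Bernstein l k x) * (real (Suc m) * x - real k)"
  have deriv: "(split_trial_cdf m k has_real_derivative ?D x) (at x)" for x
    unfolding m j by (rule has_real_derivative_split_trial_cdf)
  have c: "real k - 1 \<le> real m * ?c" "real m * ?c \<le> real k"
    using k by (simp_all add: field_simps)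
  have drop: "0 \<le> Bernstein l j x - Bernstein l k x" if "min q ?c \<le> x" "x \<le> max q ?c" for x
  proof -
    have "real m * x \<le> real m * max q ?c" using that by (intro mult_left_mono) auto
    also have "\<dots> \<le> real k" using q c by (auto simp: max_def)
    finally have upper: "real m * x \<le> real k" .
    have "real k - 1 \<le> real m * min q ?c" using q c by (auto simp: min_def)
    also have "\<dots> \<le> real m * x" using that by (intro mult_left_mono) auto
    finally have "0 \<le> real m * x" using k by linarith
    then have "0 \<le> x" using k by (simp add: zero_le_mult_iff)
    moreover have "x \<le> 1"
    proof (rule mult_left_le_imp_le)
      show "real m * x \<le> real m * 1"
        using upper k(2) unfolding mult_1_right of_nat_le_iff[symmetric, where 'a = real]
        by (rule order_trans)
      show "0 < real m" using k by simp
    qed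
    ultimately show ?thesis using Bernstein_Suc_le[of x l j] upper m j by simp
  qed
  show ?thesis
  proof (cases "q \<le> ?c")
    case True
    then show ?thesis
    proof (rule DERIV_nonpos_imp_nonincreasing)
      fix x assume x: "q \<le> x" "x \<le> ?c"
      have "real (Suc m) * x - real k \<le> 0" using x(2) by (simp add: field_simps)
      then have "?D x \<le> 0" using drop[of x] x True by (intro mult_nonneg_nonpos) auto
      then show "\<exists>y. DERIV (split_trial_cdf m k) x :> y \<and> y \<le> 0" using deriv by blast
    qed
  next
    case False
    then have "?c \<le> q" by simp
    then show ?thesis
    proof (rule DERIV_nonneg_imp_nondecreasing)
      fix x assume x: "?c \<le> x" "x \<le> q"
      have "0 \<le> real (Suc m) * x - real k" using x(1) by (simp add: field_simps)
      then have "0 \<le> ?D x" using drop[of x] x False by (intro mult_nonneg_nonneg) auto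
      then show "\<exists>y. DERIV (split_trial_cdf m k) x :> y \<and> 0 \<le> y" using deriv by blast
    qed
  qed
qed

lemma split_trial_cdf_equal_probabilities:
  "split_trial_cdf m k (real k / real (Suc m)) = binomial_cdf (Suc m) k (real k / real (Suc m))"
proof -
  have "real k - real m * (real k / real (Suc m)) = real k / real (Suc m)"
    by (simp add: field_simps)
  then show ?thesis unfolding split_trial_cdf_def binomial_cdf_Suc by simp
qed

text \<open>The case in which the extra trial is a certain failure.\<close>

lemma binomial_cdf_at_mean_Suc_le:
  assumes "1 \<le> k" "k \<le> m"
  shows "binomial_cdf (Suc m) k (real k / real (Suc m)) \<le> binomial_cdf m k (real k / real m)"
proof -
  have "split_trial_cdf m k (real k / real m) = binomial_cdf m k (real k / real m)"
    using assms by (simp add: split_trial_cdf_def)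
  then show ?thesis
    using split_trial_cdf_minimal[OF assms, of "real k / real m"] assms
    by (simp add: split_trial_cdf_equal_probabilities del: of_nat_Suc)
qed

text \<open>The case in which the extra trial is a certain success.\<close>

lemma binomial_cdf_at_mean_Suc_Suc_le:
  assumes "Suc k \<le> m"
  shows "binomial_cdf (Suc m) (Suc k) (real (Suc k) / real (Suc m)) \<le>
    binomial_cdf m k (real k / real m)"
proof -
  have "split_trial_cdf m (Suc k) (real k / real m) = binomial_cdf m k (real k / real m)"
    using assms by (simp add: split_trial_cdf_def binomial_cdf_def)
  then show ?thesis
    using split_trial_cdf_minimal[of "Suc k" m "real k / real m"] assms
    by (simp add: split_trial_cdf_equal_probabilities del: of_nat_Suc)
qed

section \<open>The distribution function at the mean\<close>

text \<open>As long as \<open>k < n - 1\<close>, a failing trial can be removed. On the diagonal \<open>k = n - 1\<close> a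
  succeeding one is removed instead, until \<open>n = 2\<close>, \<open>k = 1\<close> is reached, where the bound is
  an equality.\<close>

lemma binomial_cdf_at_mean_le:
  assumes "1 \<le> k" "k < n"
  shows "binomial_cdf n k (real k / real n) \<le> 3 / 4"
  using assms
proof (induction n arbitrary: k)
  case 0
  then show ?case by simp
next
  case (Suc m)
  consider "k < m" | "k = m" "m = 1" | "k = m" "m \<ge> 2" using Suc.prems by linarith
  then show ?case
  proof cases
    case 1
    then show ?thesis
      using binomial_cdf_at_mean_Suc_le[of k m] Suc.IH[of k] Suc.prems by linarith
  next
    case 2
    then show ?thesis
      by (simp add: binomial_cdf_def Bernstein_def power2_eq_square)
  next
    case 3
    then obtain j where j: "k = Suc j" "1 \<le> j" by (cases k) auto
    then show ?thesis
      using binomial_cdf_at_mean_Suc_Suc_le[of j m] Suc.IH[of j] 3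
      by (metis Suc_le_eq le_refl order_trans)
  qed
qed

lemma binomial_cdf_0_le:
  assumes "n \<ge> 1" "ln (4 / 3) / real n \<le> p" "p < 1"
  shows "binomial_cdf n 0 p \<le> 3 / 4"
proof -
  have "binomial_cdf n 0 p = (1 - p) ^ n" by (simp add: binomial_cdf_def Bernstein_def)
  also have "\<dots> \<le> exp (- p) ^ n"
    using assms exp_ge_add_one_self[of "- p"] by (intro power_mono) auto
  also have "\<dots> = exp (- (real n * p))" by (simp add: exp_of_nat_mult[symmetric])
  also have "\<dots> \<le> exp (- ln (4 / 3))" using assms by (simp add: field_simps)
  also have "\<dots> = 3 / 4" by (simp add: exp_minus)
  finally show ?thesis .
qed

lemma binomial_cdf_floor_mean_le:
  assumes n: "n \<ge> 1" and p: "ln (4 / 3) / real n \<le> p" "p < 1"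
  shows "binomial_cdf n (nat \<lfloor>real n * p\<rfloor>) p \<le> 3 / 4"
proof (cases "nat \<lfloor>real n * p\<rfloor> = 0")
  case True
  then show ?thesis using binomial_cdf_0_le[OF assms] by simp
next
  case False
  define k where "k = nat \<lfloor>real n * p\<rfloor>"
  have k: "1 \<le> k" using False unfolding k_def by linarith
  have "0 \<le> \<lfloor>real n * p\<rfloor>" using False by linarith
  then have kle: "real k \<le> real n * p" unfolding k_def by simp
  also have "\<dots> < real n" using n p by simp
  finally have "k < n" by simp
  have "binomial_cdf n k p \<le> binomial_cdf n k (real k / real n)"
    using kle n p by (intro binomial_cdf_antimono) (auto simp: field_simps)
  also have "\<dots> \<le> 3 / 4" using k \<open>k < n\<close> by (rule binomial_cdf_at_mean_le)
  finally show ?thesis unfolding k_def .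
qed

lemma ln_four_thirds_less: "ln (4 / 3 :: real) < 0.2877"
proof -
  \<comment> \<open>The margin is about \<open>2 * 10 ^ -5\<close>; the terms up to degree 5 of the exponential series suffice.\<close>
  have "(4 / 3 :: real) < (\<Sum>i<6. 0.2877 ^ i /\<^sub>R fact i)"
    by (simp add: eval_nat_numeral fact_numeral divide_simps)
  also have "\<dots> \<le> exp 0.2877"
    unfolding exp_def by (rule sum_le_suminf[OF summable_exp_generic]) auto
  finally have "ln (4 / 3 :: real) < ln (exp 0.2877)" by (subst ln_less_cancel_iff) auto
  then show ?thesis by simp
qed

section \<open>Binomially distributed random variables\<close>

lemma binomial_event:
  "binomially_distributed M X n p \<Longrightarrow> {\<omega> \<in> space M. X \<omega> = c} \<in> sets M"
  by (rule borel_measurable_eq) (simp_all add: binomially_distributed_def)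

lemma prob_binomial_eq:
  "binomially_distributed M X n p \<Longrightarrow> i \<le> n \<Longrightarrow> \<P>(\<omega> in M. X \<omega> = real i) = Bernstein n i p"
  by (auto simp: binomially_distributed_def Bernstein_def)

lemma (in prob_space) prob_binomial_in:
  assumes X: "binomially_distributed M X n p" and "I \<subseteq> {..n}"
  shows "\<P>(\<omega> in M. X \<omega> \<in> real ` I) = (\<Sum>i\<in>I. Bernstein n i p)"
proof -
  have fin: "finite I" using assms finite_subset by blast
  have "{\<omega> \<in> space M. X \<omega> \<in> real ` I} = (\<Union>i\<in>I. {\<omega> \<in> space M. X \<omega> = real i})" by auto
  also have "prob \<dots> = (\<Sum>i\<in>I. \<P>(\<omega> in M. X \<omega> = real i))"
    using fin binomial_event[OF X]
    by (intro finite_measure_finite_Union) (auto simp: disjoint_family_on_def)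
  also have "\<dots> = (\<Sum>i\<in>I. Bernstein n i p)"
    using assms(2) by (intro sum.cong refl prob_binomial_eq[OF X]) auto
  finally show ?thesis .
qed

text \<open>The prescribed probabilities add up to \<open>1\<close>, so \<open>X\<close> has no mass elsewhere on the real line.\<close>

lemma (in prob_space) AE_binomial_in:
  assumes X: "binomially_distributed M X n p"
  shows "AE \<omega> in M. X \<omega> \<in> real ` {..n}"
proof -
  have "\<P>(\<omega> in M. X \<omega> \<in> real ` {..n}) = 1"
    using prob_binomial_in[OF X, of "{..n}"] by simp
  moreover have "{\<omega> \<in> space M. X \<omega> \<in> real ` {..n}} = (\<Union>i\<le>n. {\<omega> \<in> space M. X \<omega> = real i})"
    by auto
  then have "{\<omega> \<in> space M. X \<omega> \<in> real ` {..n}} \<in> events"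
    using binomial_event[OF X] by auto
  ultimately show ?thesis using prob_Collect_eq_1[of "\<lambda>\<omega>. X \<omega> \<in> real ` {..n}"] by simp
qed

lemma (in prob_space) expectation_binomial:
  assumes X: "binomially_distributed M X n p"
  shows "expectation X = real n * p"
proof -
  let ?A = "\<lambda>i. {\<omega> \<in> space M. X \<omega> = real i}"
  note ev [measurable] = binomial_event[OF X]
  have [measurable]: "X \<in> borel_measurable M"
    using X by (simp add: binomially_distributed_def)
  have int: "integrable M (indicator (?A i) :: 'a \<Rightarrow> real)" for i
    by (rule integrable_real_indicator[OF ev]) (simp add: less_top[symmetric])
  have "expectation X = expectation (\<lambda>\<omega>. \<Sum>i\<le>n. real i * indicator (?A i) \<omega>)"
  proof (rule integral_cong_AE)
    show "AE \<omega> in M. X \<omega> = (\<Sum>i\<le>n. real i * indicator (?A i) \<omega>)"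
      using AE_binomial_in[OF X] AE_space
    proof eventually_elim
      case (elim \<omega>)
      then obtain j where j: "j \<le> n" "X \<omega> = real j" by auto
      have "(\<Sum>i\<le>n. real i * indicator (?A i) \<omega>) = (\<Sum>i\<le>n. if i = j then real i else 0)"
        using elim j by (intro sum.cong) (auto simp: indicator_def)
      then show ?case using j by simp
    qed
  qed measurable
  also have "\<dots> = (\<Sum>i\<le>n. real i * prob (?A i))"
    using int ev by (subst Bochner_Integration.integral_sum) (auto simp: Int_absorb2)
  also have "\<dots> = (\<Sum>i\<le>n. real i * Bernstein n i p)"
    using prob_binomial_eq[OF X] by (intro sum.cong) auto
  also have "\<dots> = real n * p" by simp
  finally show ?thesis .
qed

lemma (in prob_space) prob_binomial_gt:
  assumes X: "binomially_distributed M X n p"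
  shows "\<P>(\<omega> in M. X \<omega> > real n * p) \<ge> 1 - binomial_cdf n (nat \<lfloor>real n * p\<rfloor>) p"
proof -
  let ?k = "nat \<lfloor>real n * p\<rfloor>"
  have [measurable]: "X \<in> borel_measurable M"
    using X by (simp add: binomially_distributed_def)
  \<comment> \<open>The maximum accounts for \<open>p > 1\<close>, where \<open>?k\<close> may exceed \<open>n\<close>.\<close>
  have "1 = (\<Sum>i\<le>max n ?k. Bernstein n i p)"
    by (subst sum_Bernstein[of n p, symmetric], intro sum.mono_neutral_left)
       (auto simp: Bernstein_eq_0)
  also have "\<dots> = binomial_cdf n ?k p + (\<Sum>i\<in>{?k<..max n ?k}. Bernstein n i p)"
    unfolding binomial_cdf_def by (subst sum.union_disjoint[symmetric]) (auto intro!: sum.cong)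
  also have "{?k<..max n ?k} = {?k<..n}" by auto
  also have "(\<Sum>i\<in>{?k<..n}. Bernstein n i p) = \<P>(\<omega> in M. X \<omega> \<in> real ` {?k<..n})"
    by (rule prob_binomial_in[OF X, symmetric]) auto
  also have "\<dots> \<le> \<P>(\<omega> in M. X \<omega> > real n * p)"
    by (intro finite_measure_mono) (auto, linarith)
  finally show ?thesis by simp
qed

theorem theorem10:
  fixes M :: "'a measure" and X :: "'a \<Rightarrow> real" and n :: nat and p :: real
  assumes "prob_space M"
    and "n \<ge> 1"
    and "ln (4 / 3) / real n \<le> p" and "p < 1"
    and "binomially_distributed M X n p"
  shows "ln (4 / 3 :: real) < 0.2877 \<and>
         \<P>(\<omega> in M. X \<omega> > prob_space.expectation M X) \<ge> 1 / 4"
  using ln_four_thirds_less prob_space.prob_binomial_gt[OF assms(1,5)]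
    prob_space.expectation_binomial[OF assms(1,5)] binomial_cdf_floor_mean_le[OF assms(2-4)]
  by auto

end
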